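(* For all $a,b>0$ with $a\ne b$, $$\frac{\pi^2}{4e}P^2<A^{2-1/(\ln\pi-\ln2)}P^{1/(\ln\pi-\ln2)}<A^{2-1/\ln2}\left(\frac{A+G}{2}\right)^{1/\ln2}<XA$$ $$<A^{2/3}\left(\frac{A+G}{2}\right)^{4/3}<P^2<\frac{2^{10/3}}{\pi^2}A^{2/3}\left(\frac{A+G}{2}\right)^{4/3},$$ $$\sqrt{XA}<P<\frac{2A+G}{3}<\frac{X+A}{2},$$ $$X>\frac{2G+A}{3}>\frac{P+G}{2}.$$
   Context: For $a,b>0$ with $a\neq b$: $A=\frac{a+b}{2}$, $G=\sqrt{ab}$, $P=\frac{a-b}{2\arcsin\frac{a-b}{a+b}}$ (first Seiffert mean), and $X=A e^{G/P-1}$. *)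

theory Defs
  imports Complex_Main
begin

definition arith_mean :: "real \<Rightarrow> real \<Rightarrow> real" where
  "arith_mean a b = (a + b) / 2"

definition geom_mean :: "real \<Rightarrow> real \<Rightarrow> real" where
  "geom_mean a b = sqrt (a * b)"

(* First Seiffert mean. The formula is meant for a, b > 0 with a \<noteq> b; at a = b it
   evaluates to 0 / 0 = 0, not to the continuous extension a. *)
definition seiffert_mean :: "real \<Rightarrow> real \<Rightarrow> real" where
  "seiffert_mean a b = (a - b) / (2 * arcsin ((a - b) / (a + b)))"

definition X_mean :: "real \<Rightarrow> real \<Rightarrow> real" where
  "X_mean a b = arith_mean a b * exp (geom_mean a b / seiffert_mean a b - 1)"

end

(* Set t = |sqrt a - sqrt b| / (sqrt a + sqrt b), so that |a - b| / (a + b) = sin x with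
   t = tan (x / 2). By homogeneity take A = 1; then
     G = (1 - t^2) / (1 + t^2),  (A + G) / 2 = 1 / (1 + t^2),
     P = t / ((1 + t^2) arctan t),  X = exp ((1 - t^2) arctan t / t - 1).
   After taking logarithms the inequalities compare a function of t in (0, 1) with its limit
   at t = 0 or t = 1. Up to a positive factor and a sign, its derivative is arctan t minus a
   rational function, which has a rational derivative. In the bounds with exponents 1 / ln 2
   and 1 / (ln pi - ln 2) on both sides of ((A + G) / 2) powr (1 / ln 2) the function vanishes
   at both ends and its derivative changes sign once. *)

theory Submission
  imports Defs
begin

section \<open>A sign criterion for functions compared with their endpoint values\<close>

text \<open>A derivative that stays positive once it is nonnegative only allows the function to
  decrease and then increase.\<close>

lemma interior_less_endpoint:
  fixes f f' :: "real \<Rightarrow> real"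
  assumes cont: "continuous_on {a..b} f"
    and deriv: "\<And>x. a < x \<Longrightarrow> x < b \<Longrightarrow> (f has_real_derivative f' x) (at x)"
    and sign: "\<And>x y. a < x \<Longrightarrow> x < y \<Longrightarrow> y < b \<Longrightarrow> 0 \<le> f' x \<Longrightarrow> 0 < f' y"
    and x: "a < x" "x < b"
  shows "f x < f a \<or> f x < f b"
proof (rule ccontr)
  assume neg: "\<not> (f x < f a \<or> f x < f b)"
  \<comment> \<open>If f x were at least both endpoint values, the mean value theorem on
    \<open>{a..x}\<close> would give a point z with \<open>0 \<le> f' z\<close>; then f' is positive
    beyond x and f x < f b.\<close>
  obtain l z where z: "a < z" "z < x" "DERIV f z :> l" "f x - f a = (x - a) * l"
  proof -
    have "continuous_on {a..x} f"
      using cont by (rule continuous_on_subset) (use x in auto)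
    moreover have "\<And>z. a < z \<Longrightarrow> z < x \<Longrightarrow> f differentiable (at z)"
      using deriv x by (meson less_trans real_differentiable_def)
    ultimately show ?thesis
      using MVT[of a x f] x that by blast
  qed
  have "l = f' z"
    using z x by (intro DERIV_unique[OF z(3) deriv]) auto
  moreover have "0 \<le> (x - a) * l"
    using neg z by linarith
  ultimately have "0 \<le> f' z"
    using x by (simp add: zero_le_mult_iff)
  then have pos: "0 < f' y" if "x < y" "y < b" for y
    using sign[of z y] z that by simp
  have "f x < f b"
  proof (rule DERIV_pos_imp_increasing_open[OF x(2)])
    show "\<exists>D. DERIV f y :> D \<and> 0 < D" if "x < y" "y < b" for y
      using deriv[of y] pos[of y] that x by auto
    show "continuous_on {x..b} f"
      using cont by (rule continuous_on_subset) (use x in auto)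
  qed
  then show False
    using neg by simp
qed

section \<open>The quotient arctan t / t\<close>

text \<open>The value 1 at 0 is the limit there, so functions built from the quotient are continuous
  on \<open>{0..1}\<close> and comparable with their values at 0.\<close>

definition arctan_quot :: "real \<Rightarrow> real" where
  "arctan_quot t = (if t = 0 then 1 else arctan t / t)"

lemma arctan_quot_pos: "0 < arctan_quot t"
  by (auto simp: arctan_quot_def zero_less_divide_iff)

lemma continuous_arctan_quot: "isCont arctan_quot t"
proof (cases "t = 0")
  case True
  \<comment> \<open>The quotient is the difference quotient of arctan at 0, so its limit is the
    derivative there.\<close>
  have "((\<lambda>x. (arctan x - arctan 0) / (x - 0)) \<longlongrightarrow> inverse (1 + 0\<^sup>2)) (at (0::real))"
    using DERIV_arctan[of 0] unfolding has_field_derivative_iff by simp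
  then have "((\<lambda>x. arctan x / x) \<longlongrightarrow> 1) (at (0::real))"
    by simp
  then have "(arctan_quot \<longlongrightarrow> 1) (at 0)"
    by (rule Lim_transform_eventually)
       (auto simp: eventually_at_filter arctan_quot_def)
  then show ?thesis
    using True by (simp add: isCont_def arctan_quot_def)
next
  case False
  have "isCont (\<lambda>x. arctan x / x) t"
    using False by (intro continuous_intros)
  moreover have "\<forall>\<^sub>F x in nhds t. arctan_quot x = arctan x / x"
    using t1_space_nhds[OF False] by (rule eventually_mono) (auto simp: arctan_quot_def)
  ultimately show ?thesis
    by (simp only: isCont_cong)
qed

lemma continuous_on_arctan_quot [continuous_intros]: "continuous_on S arctan_quot"
  by (simp add: continuous_arctan_quot continuous_at_imp_continuous_on)

lemma DERIV_arctan_quot: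
  assumes "t \<noteq> 0"
  shows "(arctan_quot has_real_derivative (t / (1 + t\<^sup>2) - arctan t) / t\<^sup>2) (at t)"
proof -
  have *: "((\<lambda>x. arctan x / x) has_real_derivative (t / (1 + t\<^sup>2) - arctan t) / t\<^sup>2) (at t)"
    using assms by (auto intro!: derivative_eq_intros simp: field_simps power2_eq_square)
  have "\<forall>\<^sub>F x in nhds t. arctan_quot x = arctan x / x"
    using t1_space_nhds[OF assms] by (rule eventually_mono) (auto simp: arctan_quot_def)
  then show ?thesis
    using * by (simp only: DERIV_cong_ev[OF refl _ refl])
qed

section \<open>The logarithmic gaps and their derivatives\<close>

text \<open>In the notation of the header, \<open>seiffert_gap k\<close> is
  \<open>ln P + (1 - k) ln (1 + t\<^sup>2)\<close> and \<open>exp_gap k\<close> is \<open>ln X + k ln (1 + t\<^sup>2)\<close>,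
  both extended continuously to \<open>t = 0\<close>.\<close>

definition seiffert_gap :: "real \<Rightarrow> real \<Rightarrow> real" where
  "seiffert_gap k t = - ln (arctan_quot t) - k * ln (1 + t\<^sup>2)"

definition exp_gap :: "real \<Rightarrow> real \<Rightarrow> real" where
  "exp_gap k t = arctan_quot t * (1 - t\<^sup>2) - 1 + k * ln (1 + t\<^sup>2)"

lemma gap_0 [simp]: "seiffert_gap k 0 = 0" "exp_gap k 0 = 0"
  by (auto simp: seiffert_gap_def exp_gap_def arctan_quot_def)

lemma one_plus_sq_pos: "0 < 1 + (t::real)\<^sup>2"
  by (simp add: add_pos_nonneg)

lemma continuous_on_seiffert_gap: "continuous_on S (seiffert_gap k)"
  unfolding seiffert_gap_def
  by (intro continuous_intros ballI) (use arctan_quot_pos one_plus_sq_pos in \<open>auto simp: less_imp_neq[symmetric]\<close>)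

lemma continuous_on_exp_gap: "continuous_on S (exp_gap k)"
  unfolding exp_gap_def
  by (intro continuous_intros ballI) (use one_plus_sq_pos in \<open>auto simp: less_imp_neq[symmetric]\<close>)

text \<open>With m = 1 - 2k and 1 + m t^2 > 0, dividing the numerator by 1 + m t^2 isolates arctan:
  the sign is that of \<open>arctan t - t / (1 + m * t\<^sup>2)\<close>.\<close>

lemma DERIV_seiffert_gap:
  assumes "0 < t"
  shows "(seiffert_gap k has_real_derivative
    (arctan t * (1 + (1 - 2 * k) * t\<^sup>2) - t) / (t * arctan t * (1 + t\<^sup>2))) (at t)"
proof -
  have "0 < arctan t" "0 < 1 + t\<^sup>2"
    using assms one_plus_sq_pos by auto
  then show ?thesis
    unfolding seiffert_gap_def[abs_def]
    using assms arctan_quot_pos[of t]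
    apply (auto intro!: derivative_eq_intros DERIV_arctan_quot)
    apply (simp add: arctan_quot_def divide_simps)
    apply (simp add: algebra_simps power2_eq_square)
    done
qed

text \<open>The factor (1 + t^2) / t^2 is pulled out so that arctan stands alone against a rational
  function, with m = 2k - 1 as cubic coefficient.\<close>

lemma DERIV_exp_gap:
  assumes "0 < t"
  shows "(exp_gap k has_real_derivative
    ((t + (2 * k - 1) * t ^ 3) / (1 + t\<^sup>2)\<^sup>2 - arctan t) * (1 + t\<^sup>2) / t\<^sup>2) (at t)"
proof -
  have "0 < 1 + t\<^sup>2"
    using one_plus_sq_pos by auto
  then show ?thesis
    unfolding exp_gap_def[abs_def]
    using assms
    apply (auto intro!: derivative_eq_intros DERIV_arctan_quot)
    apply (simp add: arctan_quot_def divide_simps)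
    apply (simp add: algebra_simps power2_eq_square power3_eq_cube)
    done
qed

text \<open>For m > 0 the bracket increases in t, so the sign changes at most once, from negative to
  positive. At m = 1/3 its constant term vanishes; m = 0 compares arctan with t.\<close>

lemma DERIV_arctan_minus_rational:
  assumes "0 \<le> m"
  shows "((\<lambda>t. arctan t - t / (1 + m * t\<^sup>2)) has_real_derivative
    t\<^sup>2 * (3 * m - 1 + (m\<^sup>2 + m) * t\<^sup>2) / ((1 + t\<^sup>2) * (1 + m * t\<^sup>2)\<^sup>2)) (at t)"
proof -
  have "0 < 1 + t\<^sup>2" "0 < 1 + m * t\<^sup>2"
    using one_plus_sq_pos assms by (auto simp: add_pos_nonneg)
  then show ?thesis
    apply (auto intro!: derivative_eq_intros)
    apply (simp add: divide_simps)
    apply (simp add: algebra_simps power2_eq_square power3_eq_cube)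
    done
qed

text \<open>For m > -1 the bracket decreases in t, so the sign changes at most once, from positive
  to negative. At m = 5/3 its constant term vanishes.\<close>

lemma DERIV_rational_minus_arctan:
  "((\<lambda>t. (t + m * t ^ 3) / (1 + t\<^sup>2)\<^sup>2 - arctan t) has_real_derivative
    t\<^sup>2 * (3 * m - 5 - (m + 1) * t\<^sup>2) / (1 + t\<^sup>2) ^ 3) (at t)"
proof -
  have "0 < 1 + t\<^sup>2"
    using one_plus_sq_pos by auto
  then show ?thesis
    apply (auto intro!: derivative_eq_intros)
    apply (simp add: divide_simps)
    apply (simp add: algebra_simps power2_eq_square eval_nat_numeral)
    done
qed

section \<open>Rational bounds for arctan and numerical bounds for pi\<close>

lemma arctan_less_self:
  assumes "0 < t"
  shows "arctan t < t"
proof -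
  have "arctan t - t < arctan 0 - (0::real)"
  proof (rule DERIV_neg_imp_decreasing_open[OF assms])
    show "continuous_on {0..t} (\<lambda>t. arctan t - t)"
      by (intro continuous_intros)
    show "\<exists>D. ((\<lambda>t. arctan t - t) has_real_derivative D) (at x) \<and> D < 0" if "0 < x" for x
      using DERIV_arctan_minus_rational[of 0 x] that one_plus_sq_pos[of x]
      by (intro exI[of _ "- (x\<^sup>2 / (1 + x\<^sup>2))"]) (auto simp: power2_eq_square)
  qed
  then show ?thesis
    by simp
qed

lemma arctan_greater_rational:
  assumes "0 < t"
  shows "3 * t / (3 + t\<^sup>2) < arctan t"
proof -
  have "arctan 0 - 0 / (1 + 1/3 * 0\<^sup>2) < arctan t - t / (1 + 1/3 * t\<^sup>2)"
  proof (rule DERIV_pos_imp_increasing_open[OF assms])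
    have "1 + 1/3 * x\<^sup>2 \<noteq> 0" for x :: real
      by (metis add_pos_nonneg less_irrefl mult_nonneg_nonneg zero_le_divide_1_iff zero_le_numeral
          zero_le_power2 zero_less_one)
    then show "continuous_on {0..t} (\<lambda>t. arctan t - t / (1 + 1/3 * t\<^sup>2))"
      by (intro continuous_intros) auto
    show "\<exists>D. ((\<lambda>t. arctan t - t / (1 + 1/3 * t\<^sup>2)) has_real_derivative D) (at x) \<and> 0 < D"
      if "0 < x" for x
      using that one_plus_sq_pos[of x]
      by - (rule exI, rule conjI, rule DERIV_arctan_minus_rational,
        auto intro!: mult_pos_pos divide_pos_pos add_pos_pos simp: power2_eq_square)
  qed
  moreover have "t / (1 + 1/3 * t\<^sup>2) = 3 * t / (3 + t\<^sup>2)"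
    by (simp add: field_simps)
  ultimately show ?thesis
    by simp
qed

text \<open>The two sides agree through order t^3 and their difference has a derivative with the
  single positive numerator 16 t^4. This is the comparison needed for X > (2G + A) / 3.\<close>

lemma arctan_less_rational:
  assumes "0 < t" "t < 1"
  shows "arctan t < t * (3 + t\<^sup>2) / ((3 - t\<^sup>2) * (1 + t\<^sup>2))"
proof -
  let ?f = "\<lambda>t::real. t * (3 + t\<^sup>2) / ((3 - t\<^sup>2) * (1 + t\<^sup>2)) - arctan t"
  have pos: "0 < 3 - x\<^sup>2" "0 < 1 + x\<^sup>2" if "0 \<le> x" "x \<le> t" for x
    using that assms one_plus_sq_pos[of x] power_le_one[of x 2] by auto
  have "?f 0 < ?f t"
  proof (rule DERIV_pos_imp_increasing_open[OF assms(1)])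
    show "continuous_on {0..t} ?f"
      using pos by (intro continuous_intros) (auto simp: less_imp_neq[symmetric])
    show "\<exists>D. (?f has_real_derivative D) (at x) \<and> 0 < D" if "0 < x" "x < t" for x
    proof (intro exI conjI)
      have *: "0 < 3 - x\<^sup>2" "0 < 1 + x\<^sup>2"
        using pos[of x] that by auto
      then show "(?f has_real_derivative
          16 * x ^ 4 / ((3 - x\<^sup>2)\<^sup>2 * (1 + x\<^sup>2)\<^sup>2)) (at x)"
        apply (auto intro!: derivative_eq_intros)
        apply (simp add: divide_simps)
        apply (simp add: algebra_simps eval_nat_numeral)
        done
      show "0 < 16 * x ^ 4 / ((3 - x\<^sup>2)\<^sup>2 * (1 + x\<^sup>2)\<^sup>2)"
        using * that by auto
    qed
  qed
  then show ?thesis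
    by simp
qed

lemma pi_gt_3: "3 < pi"
  using arctan_greater_rational[of 1] by (simp add: arctan_one)

text \<open>Machin's formula with the subtracted term at 1/239 dropped.\<close>

lemma pi_less_16_div_5: "pi < 16 / 5"
proof -
  have "0 < arctan (1 / 239)" "arctan (1 / 5) < 1 / 5"
    by (simp, rule arctan_less_self, simp)
  then show ?thesis
    using machin by linarith
qed

section \<open>Monotonicity and signs of the gaps\<close>

text \<open>For k = 1/3 the weight 1 - 2k is again 1/3, so \<open>arctan_greater_rational\<close>
  makes the derivative positive. Comparison with t = 0 and with t = 1 gives the two bounds on P^2
  with exponent 4/3.\<close>

lemma seiffert_gap_third_strict_mono:
  assumes "0 \<le> s" "s < t"
  shows "seiffert_gap (1/3) s < seiffert_gap (1/3) t"
proof (rule DERIV_pos_imp_increasing_open[OF assms(2)])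
  show "continuous_on {s..t} (seiffert_gap (1/3))"
    by (rule continuous_on_seiffert_gap)
  fix x assume "s < x"
  then have x: "0 < x"
    using assms by simp
  have "x < arctan x * (1 + (1 - 2 * (1/3)) * x\<^sup>2)"
    using arctan_greater_rational[OF x] by (simp add: field_simps add_pos_nonneg)
  then show "\<exists>D. (seiffert_gap (1/3) has_real_derivative D) (at x) \<and> 0 < D"
    using x one_plus_sq_pos[of x] by - (rule exI, rule conjI, rule DERIV_seiffert_gap, auto)
qed

text \<open>For A = 1 this gap is ln P, which decreases in t to its value at t = 1; thus P > 2A /
  pi.\<close>

lemma seiffert_gap_one_greater:
  assumes "0 < t" "t < 1"
  shows "ln 2 - ln pi < seiffert_gap 1 t"
proof -
  have "seiffert_gap 1 1 < seiffert_gap 1 t"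
  proof (rule DERIV_neg_imp_decreasing_open[OF assms(2)])
    show "continuous_on {t..1} (seiffert_gap 1)"
      by (rule continuous_on_seiffert_gap)
    fix x assume "t < x"
    then have x: "0 < x"
      using assms by simp
    have "arctan x * (1 + (1 - 2 * 1) * x\<^sup>2) \<le> arctan x * 1"
      using x by (intro mult_left_mono) auto
    also have "\<dots> < x"
      using arctan_less_self[OF x] by simp
    finally show "\<exists>D. (seiffert_gap 1 has_real_derivative D) (at x) \<and> D < 0"
      using x one_plus_sq_pos[of x]
      by - (rule exI, rule conjI, rule DERIV_seiffert_gap, auto simp: divide_less_0_iff)
  qed
  moreover have "seiffert_gap 1 1 = ln 2 - ln pi"
    using ln_realpow[of 2 2] by (simp add: seiffert_gap_def arctan_quot_def arctan_one ln_div)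
  ultimately show ?thesis
    by simp
qed

text \<open>The gap vanishes at 0 and 1, so \<open>interior_less_endpoint\<close> suffices. It is
  used twice: first on \<open>?E\<close>, which carries the sign of the derivative, then on the gap.
  The bound on k makes m positive.\<close>

lemma seiffert_gap_neg:
  assumes k: "k < 1 / 2" and root: "seiffert_gap k 1 = 0" and t: "0 < t" "t < 1"
  shows "seiffert_gap k t < 0"
proof -
  define m where "m = 1 - 2 * k"
  have m: "0 < m"
    using k by (simp add: m_def)
  let ?E = "\<lambda>t. arctan t - t / (1 + m * t\<^sup>2)"
  let ?E' = "\<lambda>t. t\<^sup>2 * (3 * m - 1 + (m\<^sup>2 + m) * t\<^sup>2) / ((1 + t\<^sup>2) * (1 + m * t\<^sup>2)\<^sup>2)"
  let ?D = "\<lambda>t. (arctan t * (1 + m * t\<^sup>2) - t) / (t * arctan t * (1 + t\<^sup>2))"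
  have wpos: "0 < 1 + m * x\<^sup>2" for x
    using m by (simp add: add_pos_nonneg)
  \<comment> \<open>As \<open>?E 0\<close> is 0, a nonnegative value at x excludes the first
    alternative and forces \<open>?E\<close> to be positive from then on.\<close>
  have E: "?E x < 0 \<or> ?E x < ?E y" if "0 < x" "x < y" for x y
  proof -
    have "?E x < ?E 0 \<or> ?E x < ?E y"
    proof (rule interior_less_endpoint[where f = ?E and f' = ?E'])
      show "continuous_on {0..y} ?E"
        using wpos by (intro continuous_intros) (auto simp: less_imp_neq[symmetric])
      show "(?E has_real_derivative ?E' z) (at z)" for z
        using m by (intro DERIV_arctan_minus_rational) simp
      fix u v assume uv: "0 < u" "u < v" "0 \<le> ?E' u"
      then have "0 \<le> 3 * m - 1 + (m\<^sup>2 + m) * u\<^sup>2"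
        using wpos[of u] one_plus_sq_pos[of u]
        by (auto simp: zero_le_divide_iff zero_le_mult_iff mult_le_0_iff not_le[symmetric])
      also have "\<dots> < 3 * m - 1 + (m\<^sup>2 + m) * v\<^sup>2"
        using uv m by (auto intro!: mult_strict_left_mono power_strict_mono add_pos_pos)
      finally show "0 < ?E' v"
        using uv wpos[of v] one_plus_sq_pos[of v] by (auto intro!: divide_pos_pos mult_pos_pos)
    qed (use that in auto)
    then show ?thesis
      by simp
  qed
  have sgn: "(0 \<le> ?D x \<longleftrightarrow> 0 \<le> ?E x) \<and> (0 < ?D x \<longleftrightarrow> 0 < ?E x)" if "0 < x" for x
  proof -
    have "?D x = ?E x * ((1 + m * x\<^sup>2) / (x * arctan x * (1 + x\<^sup>2)))"
    proof -
      have "?E x * (1 + m * x\<^sup>2) = arctan x * (1 + m * x\<^sup>2) - x"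
        using wpos[of x] by (simp add: left_diff_distrib)
      then show ?thesis
        by (simp only: times_divide_eq_right)
    qed
    moreover have "0 < (1 + m * x\<^sup>2) / (x * arctan x * (1 + x\<^sup>2))"
      using that wpos[of x] one_plus_sq_pos[of x] by simp
    ultimately show ?thesis
      by (metis zero_le_mult_iff zero_less_mult_iff less_imp_le not_le)
  qed
  have "seiffert_gap k t < seiffert_gap k 0 \<or> seiffert_gap k t < seiffert_gap k 1"
  proof (rule interior_less_endpoint[where f = "seiffert_gap k" and f' = ?D])
    show "continuous_on {0..1} (seiffert_gap k)"
      by (rule continuous_on_seiffert_gap)
    show "(seiffert_gap k has_real_derivative ?D x) (at x)" if "0 < x" for x
      using DERIV_seiffert_gap[OF that] by (simp add: m_def)
    show "0 < ?D y" if "0 < x" "x < y" "0 \<le> ?D x" for x y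
      using E[of x y] sgn[of x] sgn[of y] that by auto
  qed (use t in auto)
  then show ?thesis
    using root by simp
qed

text \<open>The same double use of \<open>interior_less_endpoint\<close>, applied to the negated
  gap; here k > 0 gives m + 1 > 0, which makes the bracket in \<open>?E'\<close> decrease.\<close>

lemma exp_gap_pos:
  assumes k: "0 < k" and root: "exp_gap k 1 = 0" and t: "0 < t" "t < 1"
  shows "0 < exp_gap k t"
proof -
  define m where "m = 2 * k - 1"
  have m: "0 < m + 1"
    using k by (simp add: m_def)
  let ?E = "\<lambda>t. - ((t + m * t ^ 3) / (1 + t\<^sup>2)\<^sup>2 - arctan t)"
  let ?E' = "\<lambda>t. - (t\<^sup>2 * (3 * m - 5 - (m + 1) * t\<^sup>2) / (1 + t\<^sup>2) ^ 3)"
  let ?D = "\<lambda>t. - (((t + m * t ^ 3) / (1 + t\<^sup>2)\<^sup>2 - arctan t) * (1 + t\<^sup>2) / t\<^sup>2)"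
  have E: "?E x < 0 \<or> ?E x < ?E y" if "0 < x" "x < y" for x y
  proof -
    have "?E x < ?E 0 \<or> ?E x < ?E y"
    proof (rule interior_less_endpoint[where f = ?E and f' = ?E'])
      show "continuous_on {0..y} ?E"
        using one_plus_sq_pos by (intro continuous_intros) (auto simp: less_imp_neq[symmetric])
      show "(?E has_real_derivative ?E' z) (at z)" for z
        by (intro DERIV_minus DERIV_rational_minus_arctan)
      fix u v assume uv: "0 < u" "u < v" "0 \<le> ?E' u"
      have "(m + 1) * u\<^sup>2 < (m + 1) * v\<^sup>2"
        using uv m by (auto intro!: mult_strict_left_mono power_strict_mono)
      moreover have "3 * m - 5 - (m + 1) * u\<^sup>2 \<le> 0"
        using uv one_plus_sq_pos[of u] by (auto simp: divide_le_0_iff mult_le_0_iff)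
      ultimately have "3 * m - 5 - (m + 1) * v\<^sup>2 < 0"
        by linarith
      then show "0 < ?E' v"
        using uv one_plus_sq_pos[of v] by (simp add: divide_less_0_iff mult_less_0_iff)
    qed (use that in auto)
    then show ?thesis
      by simp
  qed
  have sgn: "(0 \<le> ?D x \<longleftrightarrow> 0 \<le> ?E x) \<and> (0 < ?D x \<longleftrightarrow> 0 < ?E x)" if "0 < x" for x
    using that one_plus_sq_pos[of x]
    by (simp add: divide_le_0_iff divide_less_0_iff mult_le_0_iff mult_less_0_iff)
  have "- exp_gap k t < - exp_gap k 0 \<or> - exp_gap k t < - exp_gap k 1"
  proof (rule interior_less_endpoint[where f = "\<lambda>t. - exp_gap k t" and f' = ?D])
    show "continuous_on {0..1} (\<lambda>t. - exp_gap k t)"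
      by (intro continuous_on_minus continuous_on_exp_gap)
    show "((\<lambda>t. - exp_gap k t) has_real_derivative ?D x) (at x)" if "0 < x" for x
      using DERIV_minus[OF DERIV_exp_gap[OF that]] by (simp add: m_def)
    show "0 < ?D y" if "0 < x" "x < y" "0 \<le> ?D x" for x y
      using E[of x y] sgn[of x] sgn[of y] that by auto
  qed (use t in auto)
  then show ?thesis
    using root by simp
qed

text \<open>For k = 4/3 the coefficient 2k - 1 is 5/3, so the constant term of the bracket vanishes
  and \<open>?E\<close> decreases from 0; hence the gap decreases too.\<close>

lemma exp_gap_four_thirds_neg:
  assumes "0 < t"
  shows "exp_gap (4/3) t < 0"
proof -
  let ?m = "2 * (4/3) - 1 :: real"
  let ?E = "\<lambda>t. (t + ?m * t ^ 3) / (1 + t\<^sup>2)\<^sup>2 - arctan t"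
  have E: "?E x < 0" if "0 < x" for x
  proof -
    have "?E x < ?E 0"
    proof (rule DERIV_neg_imp_decreasing_open[OF that])
      show "continuous_on {0..x} ?E"
        using one_plus_sq_pos by (intro continuous_intros) (auto simp: less_imp_neq[symmetric])
      show "\<exists>D. (?E has_real_derivative D) (at z) \<and> D < 0" if "0 < z" for z
        using that one_plus_sq_pos[of z]
        by - (rule exI, rule conjI, rule DERIV_rational_minus_arctan,
          auto simp: divide_less_0_iff mult_less_0_iff)
    qed
    then show ?thesis
      by simp
  qed
  have "exp_gap (4/3) t < exp_gap (4/3) 0"
  proof (rule DERIV_neg_imp_decreasing_open[OF assms])
    show "continuous_on {0..t} (exp_gap (4/3))"
      by (rule continuous_on_exp_gap)
    show "\<exists>D. (exp_gap (4/3) has_real_derivative D) (at x) \<and> D < 0" if "0 < x" for x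
      using that E[of x] one_plus_sq_pos[of x]
      by - (rule exI, rule conjI, rule DERIV_exp_gap, auto simp: divide_less_0_iff mult_less_0_iff)
  qed
  then show ?thesis
    by simp
qed

text \<open>Logarithmic form of X > (2G + A) / 3 at A = 1, since (1 + t^2)(2G + 1) / 3 = 1 - t^2 /
  3.\<close>

lemma exp_gap_one_greater:
  assumes "0 < t" "t < 1"
  shows "ln (1 - t\<^sup>2 / 3) < exp_gap 1 t"
proof -
  let ?f = "\<lambda>t. exp_gap 1 t - ln (1 - t\<^sup>2 / 3)"
  have pos: "0 < 3 - x\<^sup>2" "0 < 1 - x\<^sup>2 / 3" if "0 \<le> x" "x \<le> t" for x
    using that assms power_le_one[of x 2] by auto
  have "?f 0 < ?f t"
  proof (rule DERIV_pos_imp_increasing_open[OF assms(1)])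
    show "continuous_on {0..t} ?f"
      using pos by (intro continuous_intros continuous_on_exp_gap) force+
    fix x assume x: "0 < x" "x < t"
    have p: "0 < 3 - x\<^sup>2" "0 < 1 + x\<^sup>2"
      using pos[of x] x one_plus_sq_pos[of x] by auto
    \<comment> \<open>Adding the term 2x / (3 - x^2) from the logarithm leaves a positive multiple
      of the gap in \<open>arctan_less_rational\<close>.\<close>
    let ?u = "x * (3 + x\<^sup>2) / ((3 - x\<^sup>2) * (1 + x\<^sup>2)) - arctan x"
    have "(?f has_real_derivative
        ((x + (2 * 1 - 1) * x ^ 3) / (1 + x\<^sup>2)\<^sup>2 - arctan x) * (1 + x\<^sup>2) / x\<^sup>2 + 2 * x / (3 - x\<^sup>2)) (at x)"
      using p x by (auto intro!: derivative_eq_intros DERIV_exp_gap simp: field_simps)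
    moreover have "((x + (2 * 1 - 1) * x ^ 3) / (1 + x\<^sup>2)\<^sup>2 - arctan x) * (1 + x\<^sup>2) / x\<^sup>2
        + 2 * x / (3 - x\<^sup>2) = ?u * (1 + x\<^sup>2) / x\<^sup>2"
      using p x by (simp add: divide_simps) (simp add: algebra_simps eval_nat_numeral)
    moreover have "0 < ?u * (1 + x\<^sup>2) / x\<^sup>2"
      using arctan_less_rational[of x] p x assms by simp
    ultimately show "\<exists>D. (?f has_real_derivative D) (at x) \<and> 0 < D"
      by auto
  qed
  then show ?thesis
    by simp
qed

section \<open>The inequalities normalized to A = 1\<close>

text \<open>Here m, p, g, y stand for (A + G) / 2, P, G, X at A = 1. Most claims are a gap estimate
  after taking exponentials.\<close>

lemma normalized_bounds:
  fixes t :: real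
  defines "m \<equiv> 1 / (1 + t\<^sup>2)"
    and "p \<equiv> 1 / ((1 + t\<^sup>2) * arctan_quot t)"
    and "g \<equiv> (1 - t\<^sup>2) / (1 + t\<^sup>2)"
    and "y \<equiv> exp (arctan_quot t * (1 - t\<^sup>2) - 1)"
    and "k \<equiv> 1 / (ln pi - ln 2)"
  assumes t: "0 < t" "t < 1"
  shows "pi\<^sup>2 / (4 * exp 1) * p\<^sup>2 < p powr k"
    and "p powr k < m powr (1 / ln 2)"
    and "m powr (1 / ln 2) < y"
    and "y < m powr (4 / 3)"
    and "m powr (4 / 3) < p\<^sup>2"
    and "p\<^sup>2 < 2 powr (10 / 3) / pi\<^sup>2 * m powr (4 / 3)"
    and "p < (2 + g) / 3"
    and "(1 + 2 * g) / 3 < y"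
proof -
  define L where "L = ln (1 + t\<^sup>2)"
  have w: "0 < 1 + t\<^sup>2" and q: "0 < arctan_quot t"
    by (rule one_plus_sq_pos, rule arctan_quot_pos)
  have p: "0 < p" and m: "0 < m"
    using w q by (auto simp: p_def m_def)
  have ln_m: "ln m = - L"
    using w by (simp add: m_def L_def ln_div)
  have ln_p: "ln p = seiffert_gap 1 t"
    using w q by (simp add: p_def seiffert_gap_def ln_div ln_mult)
  have p2: "p\<^sup>2 = exp (2 * ln p)"
    using p by (simp add: exp_double)
  have ln_4: "ln 4 = 2 * ln (2::real)"
    using ln_realpow[of 2 2] by simp
  have c: "0 < ln pi - ln 2"
    using pi_gt_3 by simp
  \<comment> \<open>Equivalent to pi^2 < 4e, and gives k > 2: pi / 2 < 8/5 lies below 13/8, the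
    quadratic Taylor value for exp (1/2).\<close>
  have c2: "ln pi - ln 2 < 1 / 2"
  proof -
    have "pi / 2 < 1 + 1 / 2 + (1 / 2)\<^sup>2 / 2"
      using pi_less_16_div_5 by (simp add: power2_eq_square)
    also have "\<dots> \<le> exp (1 / 2)"
      by (rule exp_lower_Taylor_quadratic) simp
    finally have "ln (pi / 2) < ln (exp (1 / 2))"
      by (subst ln_less_cancel_iff) auto
    then show ?thesis
      by (simp add: ln_div)
  qed
  have gap: "seiffert_gap r t = ln p + (1 - r) * L" for r
    by (simp add: ln_p seiffert_gap_def L_def algebra_simps)
  have gap1: "seiffert_gap r 1 = (2 - r) * ln 2 - ln pi" for r
    by (simp add: seiffert_gap_def arctan_quot_def arctan_one ln_div ln_4 algebra_simps)
  have k: "2 < k"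
    using c c2 by (simp add: k_def field_simps)

  \<comment> \<open>The bound P > 2 / pi is raised to the positive power k - 2;
    \<open>k * (ln 2 - ln pi) = - 1\<close> produces the e in the constant.\<close>
  have "(k - 2) * (ln 2 - ln pi) < (k - 2) * ln p"
    using seiffert_gap_one_greater[OF t] k by (simp add: ln_p)
  moreover have "k * (ln 2 - ln pi) = - 1"
    using c by (simp add: k_def field_simps)
  ultimately have "2 * ln pi - 2 * ln 2 - 1 + 2 * ln p < k * ln p"
    by (simp add: algebra_simps)
  moreover have "pi\<^sup>2 / (4 * exp 1) = exp (2 * ln pi - 2 * ln 2 - 1)"
    by (simp add: exp_diff exp_double)
  ultimately show "pi\<^sup>2 / (4 * exp 1) * p\<^sup>2 < p powr k"
    using p by (simp add: p2 powr_def flip: exp_add)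

  \<comment> \<open>Chosen as the root of \<open>(2 - r) * ln 2 - ln pi\<close>, the value of the
    gap at 1.\<close>
  define r where "r = 1 - (ln pi - ln 2) / ln 2"
  \<comment> \<open>This is 8 < pi^2, equivalent to r < 1/2.\<close>
  have "3 * ln 2 < 2 * ln pi"
  proof -
    have "3\<^sup>2 < pi\<^sup>2"
      using pi_gt_3 by (intro power_strict_mono) auto
    then have "ln (2 ^ 3) < ln (pi\<^sup>2)"
      by (subst ln_less_cancel_iff) auto
    then show ?thesis
      using ln_realpow[of 2 3] ln_realpow[of pi 2] by simp
  qed
  then have "r < 1 / 2"
    by (simp add: r_def field_simps)
  moreover have "seiffert_gap r 1 = 0"
    by (simp add: gap1 r_def field_simps)
  ultimately have "seiffert_gap r t < 0"
    by (rule seiffert_gap_neg[OF _ _ t])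
  then have "ln p < - ((ln pi - ln 2) / ln 2 * L)"
    by (simp add: gap r_def algebra_simps)
  then have "k * ln p < k * - ((ln pi - ln 2) / ln 2 * L)"
    using k by (intro mult_strict_left_mono) simp_all
  also have "\<dots> = 1 / ln 2 * ln m"
    using c by (simp add: k_def ln_m)
  finally show "p powr k < m powr (1 / ln 2)"
    using p m by (simp add: powr_def)

  have "0 < exp_gap (1 / ln 2) t"
    by (rule exp_gap_pos[OF _ _ t]) (auto simp: exp_gap_def)
  then show "m powr (1 / ln 2) < y"
    using m by (simp add: powr_def ln_m y_def exp_gap_def L_def)

  show "y < m powr (4 / 3)"
    using exp_gap_four_thirds_neg[OF t(1)] m
    by (simp add: powr_def ln_m y_def exp_gap_def L_def)

  show "m powr (4 / 3) < p\<^sup>2"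
    using seiffert_gap_third_strict_mono[of 0 t] t m
    by (simp add: powr_def ln_m p2 gap)

  \<comment> \<open>The value of the gap at 1 is 5/3 ln 2 - ln pi; doubling it yields the constant
    2^(10/3) / pi^2.\<close>
  have "2 * ln p < 10 / 3 * ln 2 - 2 * ln pi + 4 / 3 * ln m"
    using seiffert_gap_third_strict_mono[of t 1] t
    by (simp add: ln_m gap gap1)
  moreover have "2 powr (10 / 3) / pi\<^sup>2 = exp (10 / 3 * ln 2 - 2 * ln pi)"
    by (simp add: exp_diff exp_double powr_def)
  ultimately show "p\<^sup>2 < 2 powr (10 / 3) / pi\<^sup>2 * m powr (4 / 3)"
    using m by (simp add: p2 powr_def flip: exp_add)

  have "3 / (3 + t\<^sup>2) < arctan_quot t"
    using arctan_greater_rational[OF t(1)] t by (simp add: arctan_quot_def field_simps)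
  then have "1 / arctan_quot t < (3 + t\<^sup>2) / 3"
    using q by (simp add: field_simps add_pos_nonneg)
  then have "1 / arctan_quot t / (1 + t\<^sup>2) < (3 + t\<^sup>2) / 3 / (1 + t\<^sup>2)"
    using w by (rule divide_strict_right_mono)
  then show "p < (2 + g) / 3"
    using w by (simp add: p_def g_def field_simps)

  have "0 < 1 - t\<^sup>2 / 3"
    using t power_le_one[of t 2] by simp
  then have "1 - t\<^sup>2 / 3 < exp (exp_gap 1 t)"
    using exp_gap_one_greater[OF t] by (metis exp_less_mono exp_ln)
  also have "\<dots> = y * (1 + t\<^sup>2)"
    using w by (simp add: exp_gap_def y_def exp_add)
  finally show "(1 + 2 * g) / 3 < y"
    using w by (simp add: g_def field_simps)
qed

section \<open>From a, b to the parameter t, and the final assembly\<close>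

lemma means_parametrization:
  fixes a b :: real
  assumes "a > 0" "b > 0" "a \<noteq> b"
  obtains t where "0 < t" "t < 1"
    "geom_mean a b = arith_mean a b * ((1 - t\<^sup>2) / (1 + t\<^sup>2))"
    "seiffert_mean a b = arith_mean a b * (1 / ((1 + t\<^sup>2) * arctan_quot t))"
proof -
  define c d where "c = sqrt (max a b)" and "d = sqrt (min a b)"
  have cd: "0 < d" "d < c"
    using assms by (auto simp: c_def d_def)
  have sq: "c\<^sup>2 = max a b" "d\<^sup>2 = min a b"
    using assms by (auto simp: c_def d_def)
  define t where "t = (c - d) / (c + d)"
  have t: "0 < t" "t < 1"
    using cd by (auto simp: t_def field_simps)
  have A: "arith_mean a b = (c\<^sup>2 + d\<^sup>2) / 2"
    by (auto simp: sq arith_mean_def max_def min_def)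
  have G: "geom_mean a b = c * d"
    by (auto simp: geom_mean_def c_def d_def max_def min_def real_sqrt_mult)
  \<comment> \<open>Exchanging a and b flips the sign of both a - b and the arcsine, so the larger
    number may come first.\<close>
  have S: "seiffert_mean a b = (c\<^sup>2 - d\<^sup>2) / (2 * arcsin ((c\<^sup>2 - d\<^sup>2) / (c\<^sup>2 + d\<^sup>2)))"
  proof (cases "b \<le> a")
    case True
    then show ?thesis
      by (simp add: sq seiffert_mean_def max_def min_def)
  next
    case False
    have "- 1 \<le> (b - a) / (a + b)" "(b - a) / (a + b) \<le> 1"
      using assms by (auto simp: field_simps)
    then have "arcsin (- ((b - a) / (a + b))) = - arcsin ((b - a) / (a + b))"
      by (intro arcsin_minus) auto
    moreover have "- ((b - a) / (a + b)) = (a - b) / (a + b)"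
      by (metis minus_diff_eq minus_divide_left)
    ultimately show ?thesis
      using False by (simp add: sq seiffert_mean_def max_def min_def add.commute divide_simps)
  qed
  have w: "1 + t\<^sup>2 = 2 * (c\<^sup>2 + d\<^sup>2) / (c + d)\<^sup>2"
    using cd by (simp add: t_def power_divide divide_simps) (simp add: power2_eq_square algebra_simps)
  have w': "1 - t\<^sup>2 = 4 * c * d / (c + d)\<^sup>2"
    using cd by (simp add: t_def power_divide divide_simps) (simp add: power2_eq_square algebra_simps)
  have pos: "0 < c\<^sup>2 + d\<^sup>2" "0 < (c + d)\<^sup>2"
    using cd by (auto intro!: add_pos_pos)
  have ratio: "(c\<^sup>2 - d\<^sup>2) / (c\<^sup>2 + d\<^sup>2) = 2 * t / (1 + t\<^sup>2)"
  proof -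
    have "2 * t = 2 * (c\<^sup>2 - d\<^sup>2) / (c + d)\<^sup>2"
      using cd by (simp add: t_def divide_simps) (simp add: power2_eq_square algebra_simps)
    then show ?thesis
      using pos by (simp add: w del: right_diff_distrib_numeral distrib_left_numeral)
  qed
  \<comment> \<open>t < 1 keeps \<open>2 * arctan t\<close> in the range where arcsin inverts sin;
    the double-angle formula then evaluates the arcsine in P.\<close>
  have "\<bar>2 * arctan t\<bar> \<le> pi / 2"
    using t arctan_less_iff[of t 1] by (simp add: arctan_one)
  moreover have "sin (2 * arctan t) = 2 * t / (1 + t\<^sup>2)"
    using one_plus_sq_pos[of t] by (simp add: sin_double sin_arctan cos_arctan)
  ultimately have arcsin: "arcsin (2 * t / (1 + t\<^sup>2)) = 2 * arctan t"
    using arcsin_sin[of "2 * arctan t"] by (simp add: abs_le_iff)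
  show ?thesis
  proof
    show "0 < t" "t < 1"
      by (fact t)+
    show "geom_mean a b = arith_mean a b * ((1 - t\<^sup>2) / (1 + t\<^sup>2))"
      using pos by (simp add: A G w w' del: right_diff_distrib_numeral distrib_left_numeral)
    have "seiffert_mean a b = (c\<^sup>2 + d\<^sup>2) * ((c\<^sup>2 - d\<^sup>2) / (c\<^sup>2 + d\<^sup>2)) / (4 * arctan t)"
      using pos by (simp add: S arcsin[folded ratio])
    also have "\<dots> = arith_mean a b * (1 / ((1 + t\<^sup>2) * arctan_quot t))"
      using t one_plus_sq_pos[of t] unfolding ratio by (simp add: A arctan_quot_def mult.commute)
    finally show "seiffert_mean a b = arith_mean a b * (1 / ((1 + t\<^sup>2) * arctan_quot t))" .
  qed
qed

text \<open>Homogeneity: each mixed product has degree two, so A^2 factors out and cancels. The case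
  r = 4/3 has outer exponent 2/3.\<close>

lemma powr_two_minus_mult:
  fixes A x r :: real
  assumes "0 < A" "0 < x"
  shows "A powr (2 - r) * (A * x) powr r = A\<^sup>2 * x powr r"
proof -
  have "A powr (2 - r) * A powr r = A\<^sup>2"
    using assms by (simp flip: powr_add)
  then show ?thesis
    using assms by (simp add: powr_mult)
qed

theorem proposition5:
  fixes a b :: real
  assumes "a > 0" and "b > 0" and "a \<noteq> b"
  shows "let A = arith_mean a b; G = geom_mean a b;
             P = seiffert_mean a b; X = X_mean a b
         in (pi\<^sup>2 / (4 * exp 1) * P\<^sup>2
               < A powr (2 - 1 / (ln pi - ln 2)) * P powr (1 / (ln pi - ln 2)) \<and>
             A powr (2 - 1 / (ln pi - ln 2)) * P powr (1 / (ln pi - ln 2))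
               < A powr (2 - 1 / ln 2) * ((A + G) / 2) powr (1 / ln 2) \<and>
             A powr (2 - 1 / ln 2) * ((A + G) / 2) powr (1 / ln 2) < X * A \<and>
             X * A < A powr (2 / 3) * ((A + G) / 2) powr (4 / 3) \<and>
             A powr (2 / 3) * ((A + G) / 2) powr (4 / 3) < P\<^sup>2 \<and>
             P\<^sup>2 < 2 powr (10 / 3) / pi\<^sup>2 * A powr (2 / 3) * ((A + G) / 2) powr (4 / 3)) \<and>
            (sqrt (X * A) < P \<and> P < (2 * A + G) / 3 \<and> (2 * A + G) / 3 < (X + A) / 2) \<and>
            (X > (2 * G + A) / 3 \<and> (2 * G + A) / 3 > (P + G) / 2)"
proof -
  define A where "A = arith_mean a b"
  obtain t where t: "0 < t" "t < 1"
    and G: "geom_mean a b = A * ((1 - t\<^sup>2) / (1 + t\<^sup>2))"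
    and P: "seiffert_mean a b = A * (1 / ((1 + t\<^sup>2) * arctan_quot t))"
    using means_parametrization[OF assms] unfolding A_def by blast
  define m where "m = 1 / (1 + t\<^sup>2)"
  define p where "p = 1 / ((1 + t\<^sup>2) * arctan_quot t)"
  define g where "g = (1 - t\<^sup>2) / (1 + t\<^sup>2)"
  define y where "y = exp (arctan_quot t * (1 - t\<^sup>2) - 1)"
  note bounds = normalized_bounds[OF t, folded m_def p_def g_def y_def]
  have A: "0 < A"
    using assms by (simp add: A_def arith_mean_def)
  have w: "0 < 1 + t\<^sup>2" and q: "0 < arctan_quot t"
    by (rule one_plus_sq_pos, rule arctan_quot_pos)
  have pos: "0 < p" "0 < m" "0 < y"
    using w q by (auto simp: p_def m_def y_def)
  have P': "seiffert_mean a b = A * p" and G': "geom_mean a b = A * g"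
    by (simp_all add: P G p_def g_def)
  have "g / p = arctan_quot t * (1 - t\<^sup>2)"
    using w q by (simp add: g_def p_def field_simps)
  then have X: "X_mean a b = A * y"
    using A by (simp add: X_mean_def P' G' y_def flip: A_def)
  have M: "(A + A * g) / 2 = A * m"
    using w by (simp add: g_def m_def field_simps)
  have A2: "0 < A\<^sup>2"
    using A by simp
  have XA: "A * y * A = A\<^sup>2 * y"
    by (simp add: power2_eq_square)
  have third: "A powr (2 / 3) * (A * m) powr (4 / 3) = A\<^sup>2 * m powr (4 / 3)"
    using powr_two_minus_mult[OF A pos(2), of "4 / 3"] by simp
  have third': "2 powr (10 / 3) / pi\<^sup>2 * A powr (2 / 3) * (A * m) powr (4 / 3)
      = A\<^sup>2 * (2 powr (10 / 3) / pi\<^sup>2 * m powr (4 / 3))"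
    using third by (metis mult.assoc mult.left_commute)
  \<comment> \<open>Chains the two bounds around \<open>m powr (4 / 3)\<close>, giving X A <
    P^2.\<close>
  have "sqrt (A\<^sup>2 * y) < A * p"
    using bounds(4,5) A pos by (intro real_less_lsqrt) (auto simp: power_mult_distrib)
  moreover have "A * p < (2 * A + A * g) / 3"
    using mult_strict_left_mono[OF bounds(7) A] by (simp add: algebra_simps)
  moreover have "(2 * (A * g) + A) / 3 < A * y"
    using mult_strict_left_mono[OF bounds(8) A] by (simp add: algebra_simps)
  moreover have "pi\<^sup>2 / (4 * exp 1) * (A * p)\<^sup>2 = A\<^sup>2 * (pi\<^sup>2 / (4 * exp 1) * p\<^sup>2)"
    by (simp add: power_mult_distrib)
  \<comment> \<open>The remaining claims are linear rearrangements: (2A + G) / 3 < (X + A) / 2 of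
    (2G + A) / 3 < X, and (P + G) / 2 < (2G + A) / 3 of P < (2A + G) / 3.\<close>
  ultimately show ?thesis
    unfolding Let_def A_def[symmetric] P' G' X M XA third third'
      powr_two_minus_mult[OF A pos(1)] powr_two_minus_mult[OF A pos(2)]
    using bounds(1-6) A2
    by (simp only: power_mult_distrib mult_less_cancel_left_pos) auto
qed

end
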